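(* Let $\sigma\in\{1,i\}$. Each square quaternion matrix $A$ is $\sigma$-consimilar to a complex matrix that is a direct sum, uniquely determined up to permutation of summands, of Jordan blocks $$J_k(a+bi),\qquad a,b\in\mathbb R,\quad \begin{cases} b\ge 0&\text{if }\sigma=1,\\ a\ge 0&\text{if }\sigma=i.\end{cases}$$
   Context: $\mathbb H$ is the skew field of real quaternions with standard imaginary units $i,j,k$, and $\mathbb C=\{a+bi: a,b\in\mathbb R\}\subset\mathbb H$. For $\sigma\in\{1,i\}$, two matrices $A,B\in\mathbb H^{n\times n}$ are $\sigma$-consimilar if $B=S^{-\sigma}AS$ for some nonsingular $S\in\mathbb H^{n\times n}$, where $S^{-\sigma}:=\sigma^{-1}S^{-1}\sigma$; that is, $B=S^{-1}AS$ if $\sigma=1$ and $B=-iS^{-1}iAS$ if $\sigma=i$. $J_k(\lambda)$ is the $k\times k$ Jordan block with $\lambda$ on the diagonal, $1$ on the first superdiagonal, and $0$ elsewhere. *)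

theory Defs
  imports "HOL-Analysis.Analysis" "Jordan_Normal_Form.Jordan_Normal_Form"
begin

codatatype quat = Quat (qRe: real) (qIm1: real) (qIm2: real) (qIm3: real)

lemma quat_eq_iff:
  "x = y \<longleftrightarrow> qRe x = qRe y \<and> qIm1 x = qIm1 y \<and> qIm2 x = qIm2 y \<and> qIm3 x = qIm3 y"
  by (auto intro: quat.expand)

instantiation quat :: ab_group_add
begin

primcorec zero_quat where
  "qRe 0 = 0" | "qIm1 0 = 0" | "qIm2 0 = 0" | "qIm3 0 = 0"

primcorec plus_quat where
  "qRe (x + y) = qRe x + qRe y"
| "qIm1 (x + y) = qIm1 x + qIm1 y"
| "qIm2 (x + y) = qIm2 x + qIm2 y"
| "qIm3 (x + y) = qIm3 x + qIm3 y"

primcorec uminus_quat where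
  "qRe (- x) = - qRe x"
| "qIm1 (- x) = - qIm1 x"
| "qIm2 (- x) = - qIm2 x"
| "qIm3 (- x) = - qIm3 x"

primcorec minus_quat where
  "qRe (x - y) = qRe x - qRe y"
| "qIm1 (x - y) = qIm1 x - qIm1 y"
| "qIm2 (x - y) = qIm2 x - qIm2 y"
| "qIm3 (x - y) = qIm3 x - qIm3 y"

instance
  by standard (simp_all add: quat_eq_iff)

end

instantiation quat :: ring_1
begin

primcorec one_quat where
  "qRe 1 = 1" | "qIm1 1 = 0" | "qIm2 1 = 0" | "qIm3 1 = 0"

primcorec times_quat where
  "qRe (x * y) = qRe x * qRe y - qIm1 x * qIm1 y - qIm2 x * qIm2 y - qIm3 x * qIm3 y"
| "qIm1 (x * y) = qRe x * qIm1 y + qIm1 x * qRe y + qIm2 x * qIm3 y - qIm3 x * qIm2 y"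
| "qIm2 (x * y) = qRe x * qIm2 y - qIm1 x * qIm3 y + qIm2 x * qRe y + qIm3 x * qIm1 y"
| "qIm3 (x * y) = qRe x * qIm3 y + qIm1 x * qIm2 y - qIm2 x * qIm1 y + qIm3 x * qRe y"

instance
  by standard (simp_all add: quat_eq_iff algebra_simps)

end

definition quat_norm_sq :: "quat \<Rightarrow> real" where
  "quat_norm_sq x = (qRe x)\<^sup>2 + (qIm1 x)\<^sup>2 + (qIm2 x)\<^sup>2 + (qIm3 x)\<^sup>2"

lemma quat_norm_sq_eq_0_iff [simp]: "quat_norm_sq x = 0 \<longleftrightarrow> x = 0"
  by (auto simp: quat_norm_sq_def quat_eq_iff add_nonneg_eq_0_iff)

instantiation quat :: division_ring
begin

primcorec inverse_quat where
  "qRe (inverse x) = qRe x / quat_norm_sq x"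
| "qIm1 (inverse x) = - (qIm1 x / quat_norm_sq x)"
| "qIm2 (inverse x) = - (qIm2 x / quat_norm_sq x)"
| "qIm3 (inverse x) = - (qIm3 x / quat_norm_sq x)"

definition divide_quat :: "quat \<Rightarrow> quat \<Rightarrow> quat" where
  "divide_quat x y = x * inverse y"

instance
proof
  fix x y :: quat
  show "inverse x * x = 1" and "x * inverse x = 1" if "x \<noteq> 0"
  proof -
    have nz: "quat_norm_sq x \<noteq> 0"
      using that by simp
    have "(qRe x * qRe x + qIm1 x * qIm1 x + qIm2 x * qIm2 x + qIm3 x * qIm3 x) / quat_norm_sq x = 1"
      using nz by (simp add: quat_norm_sq_def power2_eq_square)
    then show "inverse x * x = 1" and "x * inverse x = 1"
      by (simp_all add: quat_eq_iff add_divide_distrib mult.commute)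
  qed
  show "x div y = x * inverse y"
    by (rule divide_quat_def)
  show "inverse (0 :: quat) = 0"
    by (simp add: quat_eq_iff)
qed

end

definition quat_i :: quat where "quat_i = Quat 0 1 0 0"
definition quat_j :: quat where "quat_j = Quat 0 0 1 0"
definition quat_k :: quat where "quat_k = Quat 0 0 0 1"

lemma quat_units_mult:
  "quat_i * quat_i = - 1" "quat_j * quat_j = - 1" "quat_k * quat_k = - 1"
  "quat_i * quat_j = quat_k" "quat_j * quat_k = quat_i" "quat_k * quat_i = quat_j"
  "quat_j * quat_i = - quat_k" "quat_k * quat_j = - quat_i" "quat_i * quat_k = - quat_j"
  by (simp_all add: quat_eq_iff quat_i_def quat_j_def quat_k_def)

lemma inverse_quat_i: "inverse quat_i = - quat_i"
  by (simp add: quat_eq_iff quat_i_def quat_norm_sq_def)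

definition quat_of_complex :: "complex \<Rightarrow> quat" where
  "quat_of_complex z = Quat (Re z) (Im z) 0 0"

text \<open>\<open>T\<close> is the inverse of \<open>S\<close>; multiplying \<open>T\<close> by the scalars \<open>inverse \<sigma>\<close> from the left and
  \<open>\<sigma>\<close> from the right acts on each entry.\<close>

definition consimilar_mat :: "quat \<Rightarrow> quat mat \<Rightarrow> quat mat \<Rightarrow> bool" where
  "consimilar_mat \<sigma> A B \<longleftrightarrow>
    (\<exists>n S T. {A, B, S, T} \<subseteq> carrier_mat n n \<and> S * T = 1\<^sub>m n \<and> T * S = 1\<^sub>m n \<and>
      B = map_mat (\<lambda>x. inverse \<sigma> * x * \<sigma>) T * A * S)"

lemma consimilar_mat_1: "consimilar_mat 1 A B \<longleftrightarrow> similar_mat B A"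
proof -
  have id: "map_mat (\<lambda>x. inverse 1 * x * 1) T = T" for T :: "quat mat"
    by (rule eq_matI) simp_all
  show ?thesis
  proof
    assume "consimilar_mat 1 A B"
    then obtain n S T where *: "{A, B, S, T} \<subseteq> carrier_mat n n"
      "S * T = 1\<^sub>m n" "T * S = 1\<^sub>m n" "B = T * A * S"
      unfolding consimilar_mat_def id by blast
    have "dim_row B = n"
      using *(1) by blast
    with * have "similar_mat_wit B A T S"
      unfolding similar_mat_wit_def Let_def by blast
    then show "similar_mat B A"
      unfolding similar_mat_def by blast
  next
    assume "similar_mat B A"
    then obtain n T S where *: "{B, A, T, S} \<subseteq> carrier_mat n n"
      "T * S = 1\<^sub>m n" "S * T = 1\<^sub>m n" "B = T * A * S"
      using similar_matD by metis
    have "{A, B, S, T} \<subseteq> carrier_mat n n"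
      using *(1) by simp
    with *(2-4) show "consimilar_mat 1 A B"
      unfolding consimilar_mat_def id by metis
  qed
qed

text \<open>A list of pairs \<open>(k, z)\<close> encodes the complex matrix \<open>jordan_matrix\<close>, the direct sum of the
  Jordan blocks of size \<open>k\<close> with eigenvalue \<open>z\<close>; the sizes must be positive.\<close>

definition canonical_blocks :: "quat \<Rightarrow> (nat \<times> complex) list \<Rightarrow> bool" where
  "canonical_blocks \<sigma> bs \<longleftrightarrow>
    (\<forall>(k, z) \<in> set bs. k \<ge> 1 \<and> (\<sigma> = 1 \<longrightarrow> Im z \<ge> 0) \<and> (\<sigma> = quat_i \<longrightarrow> Re z \<ge> 0))"

end

theory Submission
  imports Defs "Jordan_Normal_Form.Jordan_Normal_Form_Existence"
    "Jordan_Normal_Form.Jordan_Normal_Form_Uniqueness"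
begin

text \<open>
  Multiplication by \<open>\<sigma>\<close> turns \<open>\<sigma>\<close>-consimilarity of \<open>A\<close> and \<open>B\<close> into similarity of \<open>\<sigma> A\<close> and \<open>\<sigma> B\<close>, and
  \<open>\<sigma> J\<^sub>k(z)\<close> is similar to \<open>J\<^sub>k(\<sigma> z)\<close>, so it suffices to treat similarity with eigenvalues in the closed
  upper half plane. An \<open>n \<times> n\<close> quaternion matrix is embedded into the \<open>2n \<times> 2n\<close> complex matrices \<open>X\<close> with
  \<open>J (cnj X) = X J\<close>. The Jordan blocks of such an \<open>X\<close> are invariant under conjugation, and those with real
  eigenvalue occur with even multiplicity because the kernels of \<open>(X - r)\<^sup>k\<close> carry a quaternionic
  structure. Hence they are the blocks of some list together with their conjugates, which is the Jordan
  form of the embedded complex matrix built from the list; finally, similarity of embedded matrices over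
  the complex numbers implies similarity over the quaternions.
\<close>

section \<open>Kernels and determinants of complex matrices\<close>

interpretation cnj_hom: field_hom cnj
  by unfold_locales auto

text \<open>A basis of the kernel, taken as the columns of \<open>W\<close>, parametrises the kernel
  injectively. Arguments about vectors in the kernel thereby become matrix identities.\<close>

lemma kernel_basis_matrix:
  fixes A :: "'a::field mat"
  assumes A: "A \<in> carrier_mat nr nc"
  obtains W where "W \<in> carrier_mat nc (kernel_dim A)"
    "A * W = 0\<^sub>m nr (kernel_dim A)"
    "\<And>u. u \<in> carrier_vec (kernel_dim A) \<Longrightarrow> W *\<^sub>v u = 0\<^sub>v nc \<Longrightarrow> u = 0\<^sub>v (kernel_dim A)"
    "\<And>v. v \<in> mat_kernel A \<Longrightarrow> \<exists>u\<in>carrier_vec (kernel_dim A). v = W *\<^sub>v u"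
proof -
  interpret kernel nr nc A
    by (unfold_locales, rule A)
  obtain B where finB: "finite B" and basB: "Ker.basis B"
    using kernel_basis_exists[OF A] by auto
  obtain vs where vs: "set vs = B" "distinct vs"
    using finite_distinct_list[OF finB] by auto
  define d where "d = length vs"
  have d: "kernel_dim A = d"
    using Ker.dim_basis[OF finB basB] vs by (simp add: d_def distinct_card[symmetric])
  have Bker: "B \<subseteq> mat_kernel A" and spanB: "Ker.span B = mat_kernel A" and indep: "\<not> Ker.lin_dep B"
    using basB unfolding Ker.basis_def by auto
  have vsker: "vs ! i \<in> mat_kernel A" if "i < d" for i
    using that Bker vs(1) d_def by auto
  have vscar: "set vs \<subseteq> carrier_vec nc"
    using Bker mat_kernel_carrier[OF A] vs(1) by auto
  define W where "W = mat_of_cols nc vs"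
  have W: "W \<in> carrier_mat nc d"
    by (simp add: W_def d_def)
  \<comment> \<open>Span and linear independence of \<open>B\<close> translate into surjectivity and
    injectivity of \<open>W\<close> through this identity.\<close>
  have Wu: "W *\<^sub>v vec d (\<lambda>i. f (vs ! i)) = Ker.lincomb f B" for f
  proof -
    have "NC.lincomb f (set vs) = NC.lincomb_list (\<lambda>i. f (vs ! i)) vs"
      using NC.lincomb_as_lincomb_list_distinct[OF vscar vs(2)] .
    also have "\<dots> = mat_of_cols nc vs *\<^sub>v vec (length vs) (\<lambda>i. f (vs ! i))"
      by (rule NC.lincomb_list_as_mat_mult) (use vscar in auto)
    finally show ?thesis
      using lincomb_same[OF Bker] vs(1) by (simp add: W_def d_def)
  qed
  have colW: "col W j = vs ! j" if "j < d" for j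
    using that vscar unfolding W_def d_def by (intro col_mat_of_cols) (auto simp: subset_iff)
  show thesis
  proof (rule that[of W, unfolded d])
    show "W \<in> carrier_mat nc d" by (rule W)
    show "A * W = 0\<^sub>m nr d"
    proof (rule eq_matI)
      fix i j assume ij: "i < dim_row (0\<^sub>m nr d :: 'a mat)" "j < dim_col (0\<^sub>m nr d :: 'a mat)"
      have "A *\<^sub>v (vs ! j) = 0\<^sub>v nr"
        using mat_kernelD(2)[OF A vsker] ij by simp
      then have "(A *\<^sub>v (vs ! j)) $ i = 0"
        using ij by simp
      then show "(A * W) $$ (i, j) = 0\<^sub>m nr d $$ (i, j)"
        using ij A W colW by simp
    qed (use A W in auto)
    show "u = 0\<^sub>v d" if u: "u \<in> carrier_vec d" and 0: "W *\<^sub>v u = 0\<^sub>v nc" for u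
    proof -
      \<comment> \<open>Linear combinations are indexed by the basis vectors themselves, so the
        coordinates in \<open>u\<close> are carried over along the inverse of the enumeration
        \<open>vs\<close>.\<close>
      define f where "f v = u $ (the_inv_into {..<d} ((!) vs) v)" for v
      have inj: "inj_on ((!) vs) {..<d}"
        using vs(2) by (auto simp: inj_on_def d_def nth_eq_iff_index_eq)
      have f: "f (vs ! i) = u $ i" if "i < d" for i
        unfolding f_def using the_inv_into_f_f[OF inj] that by auto
      have "u = vec d (\<lambda>i. f (vs ! i))"
        using u f by auto
      then have "Ker.lincomb f B = 0\<^sub>v nc"
        using 0 Wu[of f] by simp
      then have "f \<in> B \<rightarrow> {0}"
        using Ker.not_lindepD[OF indep finB subset_refl, of f] by (auto simp: class_ring_simps)
      then have "f (vs ! i) = 0" if "i < d" for i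
        using that vs(1) d_def by auto
      then show ?thesis
        using u f by auto
    qed
    show "\<exists>u\<in>carrier_vec d. v = W *\<^sub>v u" if v: "v \<in> mat_kernel A" for v
    proof -
      have "v \<in> Ker.span B"
        using v spanB by simp
      then obtain a where "v = Ker.lincomb a B"
        using Ker.finite_span[OF finB] Bker by auto
      then show ?thesis
        using Wu[of a] by (intro bexI[of _ "vec d (\<lambda>i. a (vs ! i))"]) auto
    qed
  qed
qed

text \<open>The map \<open>v \<mapsto> J (cnj v)\<close> preserves the kernel of \<open>X\<close> and squares to \<open>-1\<close>. If \<open>C\<close> is its
  matrix in a basis of the kernel of size \<open>d\<close>, then \<open>C * cnj C = -1\<close>, so \<open>\<bar>det C\<bar>\<^sup>2 = (-1)\<^sup>d\<close>.\<close>

lemma even_kernel_dim: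
  fixes X J :: "complex mat"
  assumes X: "X \<in> carrier_mat m m" and J: "J \<in> carrier_mat m m"
    and JJ: "J * map_mat cnj J = - 1\<^sub>m m"
    and JX: "J * map_mat cnj X = X * J"
  shows "even (kernel_dim X)"
proof -
  define d where "d = kernel_dim X"
  obtain W where W: "W \<in> carrier_mat m d" and XW: "X * W = 0\<^sub>m m d"
    and inj: "\<And>u. u \<in> carrier_vec d \<Longrightarrow> W *\<^sub>v u = 0\<^sub>v m \<Longrightarrow> u = 0\<^sub>v d"
    and surj: "\<And>v. v \<in> mat_kernel X \<Longrightarrow> \<exists>u\<in>carrier_vec d. v = W *\<^sub>v u"
    using kernel_basis_matrix[OF X] unfolding d_def by metis
  define V where "V = J * map_mat cnj W"
  have V: "V \<in> carrier_mat m d"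
    using J W by (simp add: V_def)
  have "X * V = X * J * map_mat cnj W"
    using X J W by (simp add: V_def)
  also have "\<dots> = J * (map_mat cnj X * map_mat cnj W)"
    using X J W by (simp flip: JX)
  also have "\<dots> = 0\<^sub>m m d"
  proof -
    have "map_mat cnj (0\<^sub>m m d) = 0\<^sub>m m d"
      by (rule eq_matI) auto
    then show ?thesis
      using J by (simp add: XW flip: cnj_hom.mat_hom_mult[OF X W])
  qed
  finally have XV: "X * V = 0\<^sub>m m d" .
  have "\<exists>u\<in>carrier_vec d. col V j = W *\<^sub>v u" if j: "j < d" for j
  proof (rule surj, rule mat_kernelI[OF X])
    show "col V j \<in> carrier_vec m"
      using V j by auto
    have "X *\<^sub>v col V j = col (X * V) j"
      using X V j by (auto intro!: eq_vecI)
    then show "X *\<^sub>v col V j = 0\<^sub>v m"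
      using XV j by auto
  qed
  then obtain c where c: "\<And>j. j < d \<Longrightarrow> c j \<in> carrier_vec d \<and> col V j = W *\<^sub>v c j"
    by metis
  define C where "C = mat_of_cols d (map c [0..<d])"
  have C: "C \<in> carrier_mat d d"
    unfolding C_def by (metis length_map length_upt minus_nat.diff_0 mat_of_cols_carrier(1))
  have colC: "col C j = c j" if "j < d" for j
    using that c by (simp add: C_def)
  have WC: "W * C = V"
  proof (rule mat_col_eqI)
    fix j assume "j < dim_col V"
    then have "j < d"
      using V by simp
    then show "col (W * C) j = col V j"
      using col_mult2[OF W C] c colC by metis
  qed (use W C V in auto)
  have cC: "map_mat cnj C \<in> carrier_mat d d" "map_mat cnj W \<in> carrier_mat m d"
    "map_mat cnj J \<in> carrier_mat m m"
    using C W J by auto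
  have CC: "C * map_mat cnj C \<in> carrier_mat d d"
    using C by auto
  have "W * (C * map_mat cnj C) = V * map_mat cnj C"
    using assoc_mult_mat[OF W C cC(1)] WC by simp
  also have "\<dots> = J * (map_mat cnj W * map_mat cnj C)"
    using J cC by (simp add: V_def)
  also have "map_mat cnj W * map_mat cnj C = map_mat cnj V"
    by (simp add: cnj_hom.mat_hom_mult[OF W C] flip: WC)
  also have "map_mat cnj V = map_mat cnj J * W"
    using W unfolding V_def by (subst cnj_hom.mat_hom_mult[OF J cC(2)]) (auto intro!: eq_matI simp: scalar_prod_def)
  also have "J * (map_mat cnj J * W) = J * map_mat cnj J * W"
    using J cC W by simp
  also have "\<dots> = - W"
    using W by (simp add: JJ)
  finally have WCC: "W * (C * map_mat cnj C) = - W" .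
  \<comment> \<open>Moving everything to one side gives a product that vanishes, and injectivity of
    \<open>W\<close> then kills the other factor column by column.\<close>
  have "W * (C * map_mat cnj C + 1\<^sub>m d) = - W + W"
    using W CC by (subst mult_add_distrib_mat[OF W CC]) (auto simp: WCC)
  also have "\<dots> = 0\<^sub>m m d"
    using W by (auto intro!: eq_matI)
  finally have 0: "W * (C * map_mat cnj C + 1\<^sub>m d) = 0\<^sub>m m d" .
  have D: "C * map_mat cnj C + 1\<^sub>m d \<in> carrier_mat d d"
    using CC by auto
  have "col (C * map_mat cnj C + 1\<^sub>m d) j = 0\<^sub>v d" if j: "j < d" for j
  proof (rule inj)
    show "W *\<^sub>v col (C * map_mat cnj C + 1\<^sub>m d) j = 0\<^sub>v m"
      using col_mult2[OF W D j] j by (simp add: 0)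
  qed (use D j in auto)
  then have "C * map_mat cnj C + 1\<^sub>m d = 0\<^sub>m d d"
    using D by (intro mat_col_eqI) auto
  then have "(C * map_mat cnj C + 1\<^sub>m d) $$ (i, j) = 0" if "i < d" "j < d" for i j
    using that by simp
  then have "C * map_mat cnj C = (-1) \<cdot>\<^sub>m 1\<^sub>m d"
    using CC by (intro eq_matI) (auto simp: add_eq_0_iff2 simp del: index_mult_mat(1))
  then have "det (C * map_mat cnj C) = (-1) ^ d"
    by simp
  then have "det C * cnj (det C) = (-1) ^ d"
    by (simp add: det_mult[OF C cC(1)])
  then have sq: "complex_of_real ((cmod (det C))\<^sup>2) = (-1) ^ d"
    by (simp only: complex_norm_square)
  have "even d"
  proof (rule ccontr)
    assume "odd d"
    then have "complex_of_real ((cmod (det C))\<^sup>2) = complex_of_real (- 1)"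
      using sq by simp
    then have "(cmod (det C))\<^sup>2 = - 1"
      by (simp only: of_real_eq_iff)
    then show False
      using zero_le_power2[of "cmod (det C)"] by simp
  qed
  then show ?thesis
    by (simp add: d_def)
qed

text \<open>The determinant is a polynomial in \<open>t\<close>, and the value at \<open>c\<close>
  shows that it is not the zero polynomial.\<close>

lemma finite_zeros_det_pencil:
  fixes A B :: "'a::field mat"
  assumes "A \<in> carrier_mat n n" "B \<in> carrier_mat n n" "det (A + c \<cdot>\<^sub>m B) \<noteq> 0"
  shows "finite {t. det (A + t \<cdot>\<^sub>m B) = 0}"
proof -
  define P where "P = mat n n (\<lambda>ij. [:A $$ ij, B $$ ij:])"
  have "poly (det P) t = det (A + t \<cdot>\<^sub>m B)" for t
  proof -
    have "comm_ring_hom (\<lambda>p :: 'a poly. poly p t)" ..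
    from comm_ring_hom.hom_det[OF this, of P, symmetric] show ?thesis
      by (rule trans, intro arg_cong[of _ _ det] eq_matI) (use assms(1,2) in \<open>auto simp: P_def\<close>)
  qed
  moreover from this have "det P \<noteq> 0"
    using assms(3) by (metis poly_0)
  ultimately show ?thesis
    using poly_roots_finite[of "det P"] by simp
qed

section \<open>Lists of Jordan blocks\<close>

text \<open>The conjugating matrix is the block permutation that exchanges the two summands of the
  underlying space.\<close>

lemma similar_mat_four_block_swap:
  fixes A B :: "'a::comm_ring_1 mat"
  assumes A: "A \<in> carrier_mat n n" and B: "B \<in> carrier_mat m m"
  shows "similar_mat (four_block_mat A (0\<^sub>m n m) (0\<^sub>m m n) B)
    (four_block_mat B (0\<^sub>m m n) (0\<^sub>m n m) A)"
proof (rule similar_matI)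
  let ?P = "four_block_mat (0\<^sub>m n m) (1\<^sub>m n) (1\<^sub>m m) (0\<^sub>m m n) :: 'a mat"
  let ?Q = "four_block_mat (0\<^sub>m m n) (1\<^sub>m m) (1\<^sub>m n) (0\<^sub>m n m) :: 'a mat"
  let ?D = "four_block_mat B (0\<^sub>m m n) (0\<^sub>m n m) A"
  show "?P * ?Q = 1\<^sub>m (n + m)"
    by (subst mult_four_block_mat[of _ n m _ n _ m _ _ n _ m]) (auto intro!: eq_matI)
  show "?Q * ?P = 1\<^sub>m (n + m)"
    by (subst mult_four_block_mat[of _ m n _ m _ n _ _ m _ n])
      (auto intro!: eq_matI simp: add.commute)
  have "?P * ?D = four_block_mat (0\<^sub>m n m) A B (0\<^sub>m m n)"
    using A B by (subst mult_four_block_mat[of _ n m _ n _ m _ _ m _ n]) auto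
  then show "four_block_mat A (0\<^sub>m n m) (0\<^sub>m m n) B = ?P * ?D * ?Q"
    using A B by (simp only:, subst mult_four_block_mat[of _ n m _ n _ m _ _ n _ m]) auto
  have "?D \<in> carrier_mat (m + n) (m + n)" "?P \<in> carrier_mat (n + m) (m + n)"
    "?Q \<in> carrier_mat (m + n) (n + m)" "four_block_mat A (0\<^sub>m n m) (0\<^sub>m m n) B \<in> carrier_mat (n + m) (n + m)"
    using A B by (simp_all add: four_block_carrier_mat)
  then show "{four_block_mat A (0\<^sub>m n m) (0\<^sub>m m n) B, ?D, ?P, ?Q} \<subseteq> carrier_mat (n + m) (n + m)"
    unfolding add.commute[of m n] by blast
qed

lemma jordan_matrix_append:
  "jordan_matrix (xs @ ys) = four_block_mat (jordan_matrix xs)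
    (0\<^sub>m (sum_list (map fst xs)) (sum_list (map fst ys)))
    (0\<^sub>m (sum_list (map fst ys)) (sum_list (map fst xs))) (jordan_matrix ys)"
  using jordan_matrix_dim[of xs] jordan_matrix_dim[of ys]
  by (simp add: jordan_matrix_def diag_block_mat_append Let_def)

text \<open>The first block \<open>x\<close> of \<open>xs\<close> occurs in
  \<open>ys = us @ x # vs\<close>. The induction hypothesis compares the remaining blocks with
  \<open>vs @ us\<close>, and a single swap of two diagonal blocks turns
  \<open>(x # vs) @ us\<close> into \<open>ys\<close>.\<close>

lemma similar_jordan_matrix_mset_eq:
  fixes xs ys :: "(nat \<times> 'a::comm_ring_1) list"
  assumes "mset xs = mset ys"
  shows "similar_mat (jordan_matrix xs) (jordan_matrix ys)"
  using assms
proof (induction xs arbitrary: ys)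
  case Nil
  then show ?case
    by (simp add: similar_mat_refl[OF jordan_matrix_carrier])
next
  case (Cons x xs)
  then have "x \<in> set ys"
    by (metis list.set_intros(1) mset_eq_setD)
  then obtain us vs where ys: "ys = us @ x # vs"
    by (auto simp: in_set_conv_decomp)
  let ?s = "\<lambda>bs :: (nat \<times> 'a) list. sum_list (map fst bs)"
  have "mset xs = mset (vs @ us)"
    using Cons.prems ys by simp
  then have IH: "similar_mat (jordan_matrix xs) (jordan_matrix (vs @ us))"
    by (rule Cons.IH)
  have s: "?s xs = ?s (vs @ us)"
    using \<open>mset xs = mset (vs @ us)\<close> by (metis mset_map sum_mset_sum_list)
  have "similar_mat (jordan_matrix ([x] @ xs)) (jordan_matrix ([x] @ (vs @ us)))"
    unfolding jordan_matrix_append[of "[x]"] s[symmetric]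
    by (rule similar_mat_four_block_0_0[OF similar_mat_refl[OF jordan_matrix_carrier] IH
      jordan_matrix_carrier jordan_matrix_carrier])
  also have "[x] @ vs @ us = (x # vs) @ us"
    by simp
  finally have 1: "similar_mat (jordan_matrix (x # xs)) (jordan_matrix ((x # vs) @ us))"
    by simp
  have "similar_mat (jordan_matrix ((x # vs) @ us)) (jordan_matrix (us @ x # vs))"
    unfolding jordan_matrix_append
    by (rule similar_mat_four_block_swap) (rule jordan_matrix_carrier)+
  with 1 show ?case
    unfolding ys by (rule similar_mat_trans)
qed

text \<open>The number of blocks of each positive size and eigenvalue can be computed from
  \<open>A\<close> alone, and \<open>jordan_nf\<close> excludes blocks of size zero.\<close>

lemma jordan_nf_mset_unique:
  fixes A :: "'a::field mat"
  assumes xs: "jordan_nf A xs" and ys: "jordan_nf A ys"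
  shows "mset xs = mset ys"
proof (rule multiset_eqI)
  fix b :: "nat \<times> 'a"
  obtain k z where b: "b = (k, z)"
    by force
  show "count (mset xs) b = count (mset ys) b"
  proof (cases "k = 0")
    case True
    then have "b \<notin> set xs" "b \<notin> set ys"
      using xs ys b unfolding jordan_nf_def by force+
    then show ?thesis
      by (metis count_eq_zero_iff set_mset_mset)
  next
    case False
    show ?thesis
      using compute_nr_of_jordan_blocks[OF xs False, of z]
        compute_nr_of_jordan_blocks[OF ys False, of z]
      by (simp add: b count_mset count_list_eq_length_filter)
  qed
qed

lemma jordan_nf_complex_exists:
  fixes A :: "complex mat"
  assumes "A \<in> carrier_mat n n"
  obtains bs where "jordan_nf A bs"
  using char_poly_factorized[OF assms] jordan_nf_exists[OF assms] by metis

section \<open>Block lists under complex conjugation\<close>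

abbreviation cnj_blocks :: "(nat \<times> complex) list \<Rightarrow> (nat \<times> complex) list" where
  "cnj_blocks \<equiv> map (map_prod id cnj)"

lemma jordan_matrix_cnj: "map_mat cnj (jordan_matrix bs) = jordan_matrix (cnj_blocks bs)"
proof (induction bs)
  case Nil
  then show ?case
    by (auto simp: jordan_matrix_def)
next
  case (Cons b bs)
  obtain n a where b: "b = (n, a)"
    by force
  have "sum_list (map fst (cnj_blocks bs)) = sum_list (map fst bs)"
    by (simp add: comp_def)
  moreover have "map_mat cnj (jordan_block n a) = jordan_block n (cnj a)"
    "map_mat cnj (0\<^sub>m k l) = 0\<^sub>m k l" for k l
    by (auto intro!: eq_matI)
  ultimately show ?case
    by (simp add: b jordan_matrix_Cons Cons.IH comp_def
        map_four_block_mat[OF jordan_block_carrier zero_carrier_mat zero_carrier_mat jordan_matrix_carrier])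
qed

text \<open>Stated for semiring homomorphisms so as to cover both complex conjugation and the
  embedding \<open>quat_of_complex\<close> into a noncommutative ring.\<close>

lemma similar_mat_map:
  assumes "semiring_hom h" and "similar_mat A B"
  shows "similar_mat (map_mat h A) (map_mat h B)"
proof -
  interpret h: semiring_hom h by fact
  obtain n P Q where *: "{A, B, P, Q} \<subseteq> carrier_mat n n" "P * Q = 1\<^sub>m n" "Q * P = 1\<^sub>m n"
    "A = P * B * Q"
    using similar_matD[OF assms(2)] by blast
  then have c: "A \<in> carrier_mat n n" "B \<in> carrier_mat n n" "P \<in> carrier_mat n n" "Q \<in> carrier_mat n n"
    by auto
  show ?thesis
  proof (rule similar_matI[of _ _ "map_mat h P" "map_mat h Q" n])
    show "map_mat h P * map_mat h Q = 1\<^sub>m n" "map_mat h Q * map_mat h P = 1\<^sub>m n"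
      using c *(2,3) by (simp_all add: h.mat_hom_one flip: h.mat_hom_mult)
    have "map_mat h (P * B * Q) = map_mat h P * map_mat h B * map_mat h Q"
      using c by (simp add: h.mat_hom_mult[of _ n n _ n])
    then show "map_mat h A = map_mat h P * map_mat h B * map_mat h Q"
      using *(4) by simp
  qed (use c in auto)
qed

lemma count_image_mset_inj:
  assumes "inj f"
  shows "count (image_mset f M) (f x) = count M x"
  by (induction M) (auto simp: inj_eq[OF assms])

text \<open>One element is kept from each conjugate pair: all pairs \<open>(k, z)\<close> with
  \<open>z\<close> in the open upper half plane, and half of the copies of those with
  \<open>z\<close> real.\<close>

lemma cnj_symmetric_mset:
  fixes M :: "(nat \<times> complex) multiset"
  assumes sym: "\<And>k z. count M (k, cnj z) = count M (k, z)"
    and even: "\<And>k z. z \<in> \<real> \<Longrightarrow> even (count M (k, z))"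
  shows "\<exists>bs. (\<forall>(k, z) \<in> set bs. (k, z) \<in># M \<and> Im z \<ge> 0) \<and> M = mset (bs @ cnj_blocks bs)"
proof -
  define f where "f = (\<lambda>(k, z). if Im z > 0 then count M (k, z)
    else if Im z = 0 then count M (k, z) div 2 else 0)"
  have le: "f x \<le> count M x" for x
    by (auto simp: f_def split: prod.split)
  have pos: "x \<in># M" if "f x > 0" for x
    using le[of x] that by (simp flip: count_greater_zero_iff)
  then have "{x. f x > 0} \<subseteq> set_mset M"
    by auto
  then have "finite {x. f x > 0}"
    by (rule finite_subset) simp
  then have f: "count (Abs_multiset f) = f"
    by (rule count_Abs_multiset)
  obtain bs where bs: "mset bs = Abs_multiset f"
    using ex_mset by blast
  have cnt: "count (mset bs) = f"
    by (simp add: bs f)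
  have cnt': "count (mset (cnj_blocks bs)) (k, z) = f (k, cnj z)" for k z
  proof -
    have "inj (map_prod id cnj :: nat \<times> complex \<Rightarrow> _)"
      by (auto simp: inj_def)
    from count_image_mset_inj[OF this, of "mset bs" "(k, cnj z)"] show ?thesis
      by (simp add: cnt)
  qed
  have "M = mset (bs @ cnj_blocks bs)"
  proof (rule multiset_eqI)
    fix x :: "nat \<times> complex"
    obtain k z where x: "x = (k, z)"
      by force
    \<comment> \<open>For nonreal \<open>z\<close> exactly one of \<open>z\<close> and
      \<open>cnj z\<close> lies above the real axis and contributes the full count; for real
      \<open>z\<close> both terms are the same half of an even number.\<close>
    have "count M (k, z) = f (k, z) + f (k, cnj z)"
      using sym[of k z] even[of z k] by (auto simp: f_def complex_is_Real_iff elim!: evenE)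
    then show "count M x = count (mset (bs @ cnj_blocks bs)) x"
      by (simp only: x mset_append count_union cnt cnt')
  qed
  moreover have "(k, z) \<in># M \<and> Im z \<ge> 0" if "(k, z) \<in> set bs" for k z
  proof -
    have "f (k, z) > 0"
      using that by (simp flip: cnt)
    then show ?thesis
      using pos by (auto simp: f_def split: if_splits)
  qed
  ultimately show ?thesis
    by blast
qed

text \<open>Off the real axis only one of the two halves of the list can contribute to a count; on
  the real axis both contribute equally, and a factor of two cancels.\<close>

lemma upper_half_blocks_unique:
  assumes nonneg: "\<forall>(k, z) \<in> set bs. Im z \<ge> 0" "\<forall>(k, z) \<in> set bs'. Im z \<ge> 0"
    and eq: "mset (bs @ cnj_blocks bs) = mset (bs' @ cnj_blocks bs')"
  shows "mset bs = mset bs'"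
proof (rule multiset_eqI)
  fix x :: "nat \<times> complex"
  obtain k z where x: "x = (k, z)"
    by force
  have inj: "inj (map_prod id cnj :: nat \<times> complex \<Rightarrow> _)"
    by (auto simp: inj_def)
  have cnt: "count (mset (cnj_blocks cs)) (k, z) = count (mset cs) (k, cnj z)" for cs
    using count_image_mset_inj[OF inj, of "mset cs" "(k, cnj z)"] by simp
  have 0: "count (mset cs) (k, w) = 0"
    if "\<forall>(k, z) \<in> set cs. Im z \<ge> 0" "Im w < 0" for cs :: "(nat \<times> complex) list" and w
  proof -
    have "(k, w) \<notin> set cs"
      using that by force
    then show ?thesis
      by (metis count_eq_zero_iff set_mset_mset)
  qed
  have sum: "count (mset bs) (k, z) + count (mset bs) (k, cnj z) =
    count (mset bs') (k, z) + count (mset bs') (k, cnj z)"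
    using arg_cong[OF eq, of "\<lambda>M. count M (k, z)"] by (simp only: mset_append count_union cnt)
  consider "Im z < 0" | "Im z > 0" | "cnj z = z"
    by (metis complex_is_Real_iff linorder_less_linear Reals_cnj_iff)
  then show "count (mset bs) x = count (mset bs') x"
    unfolding x
  proof cases
    case 1
    then show "count (mset bs) (k, z) = count (mset bs') (k, z)"
      by (simp add: 0[OF nonneg(1)] 0[OF nonneg(2)])
  next
    case 2
    then have "count (mset bs) (k, cnj z) = 0" "count (mset bs') (k, cnj z) = 0"
      by (simp_all add: 0[OF nonneg(1)] 0[OF nonneg(2)])
    with sum show "count (mset bs) (k, z) = count (mset bs') (k, z)"
      by simp
  next
    case 3
    with sum show "count (mset bs) (k, z) = count (mset bs') (k, z)"
      by simp
  qed
qed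

section \<open>The complex adjoint of a quaternion matrix\<close>

text \<open>A quaternion is written as \<open>q = qfst q + qsnd q * j\<close> with complex \<open>qfst q\<close>, \<open>qsnd q\<close>.\<close>

definition qfst :: "quat \<Rightarrow> complex" where
  "qfst q = Complex (qRe q) (qIm1 q)"

definition qsnd :: "quat \<Rightarrow> complex" where
  "qsnd q = Complex (qIm2 q) (qIm3 q)"

lemma qfst_qsnd_eqI: "qfst p = qfst q \<Longrightarrow> qsnd p = qsnd q \<Longrightarrow> p = q"
  by (simp add: qfst_def qsnd_def quat_eq_iff)

lemma qfst_qsnd_simps [simp]:
  "qfst 0 = 0" "qsnd 0 = 0" "qfst 1 = 1" "qsnd 1 = 0"
  "qfst (p + q) = qfst p + qfst q" "qsnd (p + q) = qsnd p + qsnd q"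
  "qfst (p * q) = qfst p * qfst q - qsnd p * cnj (qsnd q)"
  "qsnd (p * q) = qfst p * qsnd q + qsnd p * cnj (qfst q)"
  "qfst (quat_of_complex z) = z" "qsnd (quat_of_complex z) = 0"
  by (simp_all add: qfst_def qsnd_def complex_eq_iff quat_of_complex_def)

lemma qfst_sum [simp]: "qfst (sum f S) = (\<Sum>x\<in>S. qfst (f x))"
  by (induction S rule: infinite_finite_induct) simp_all

lemma qsnd_sum [simp]: "qsnd (sum f S) = (\<Sum>x\<in>S. qsnd (f x))"
  by (induction S rule: infinite_finite_induct) simp_all

text \<open>This is the standard embedding of quaternions into complex 2 x 2 matrices,
  \<open>a + b j\<close> going to the rows \<open>(a, b)\<close> and
  \<open>(- cnj b, cnj a)\<close>, applied blockwise.\<close>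

definition cadj :: "quat mat \<Rightarrow> complex mat" where
  "cadj A = four_block_mat (map_mat qfst A) (map_mat qsnd A)
    (map_mat (\<lambda>q. - cnj (qsnd q)) A) (map_mat (\<lambda>q. cnj (qfst q)) A)"

lemma cadj_carrier [simp]: "A \<in> carrier_mat n n \<Longrightarrow> cadj A \<in> carrier_mat (n + n) (n + n)"
  by (simp add: cadj_def)

text \<open>The block products reproduce the rule \<open>j z = cnj z j\<close> for complex
  \<open>z\<close>, which is contained in the formulas for \<open>qfst\<close> and
  \<open>qsnd\<close> of a product.\<close>

lemma cadj_mult:
  assumes A: "A \<in> carrier_mat n n" and B: "B \<in> carrier_mat n n"
  shows "cadj (A * B) = cadj A * cadj B"
proof -
  let ?f = "map_mat qfst" and ?s = "map_mat qsnd"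
  let ?s' = "map_mat (\<lambda>q. - cnj (qsnd q))" and ?f' = "map_mat (\<lambda>q. cnj (qfst q))"
  note expand = scalar_prod_def sum.distrib sum_subtractf sum_negf algebra_simps
  have "?f (A * B) = ?f A * ?f B + ?s A * ?s' B"
    by (rule eq_matI) (use A B in \<open>simp_all add: expand\<close>)
  moreover have "?s (A * B) = ?f A * ?s B + ?s A * ?f' B"
    by (rule eq_matI) (use A B in \<open>simp_all add: expand\<close>)
  moreover have "?s' (A * B) = ?s' A * ?f B + ?f' A * ?s' B"
    by (rule eq_matI) (use A B in \<open>simp_all add: expand\<close>)
  moreover have "?f' (A * B) = ?s' A * ?s B + ?f' A * ?f' B"
    by (rule eq_matI) (use A B in \<open>simp_all add: expand\<close>)
  ultimately show ?thesis
    unfolding cadj_def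
    using A B by (subst mult_four_block_mat[of _ n n _ n _ n _ _ n _ n]) simp_all
qed

lemma cadj_one: "cadj (1\<^sub>m n) = 1\<^sub>m (n + n)"
  unfolding cadj_def
  by (auto intro!: eq_matI)

lemma cadj_inj:
  assumes A: "A \<in> carrier_mat n n" and B: "B \<in> carrier_mat n n" and eq: "cadj A = cadj B"
  shows "A = B"
proof (rule eq_matI)
  fix i j assume ij: "i < dim_row B" "j < dim_col B"
  then have "cadj A $$ (i, j) = cadj B $$ (i, j)" "cadj A $$ (i, j + n) = cadj B $$ (i, j + n)"
    by (simp_all add: eq)
  then show "A $$ (i, j) = B $$ (i, j)"
    using A B ij by (auto simp: cadj_def intro: qfst_qsnd_eqI)
qed (use A B in auto)

text \<open>This is the complex adjoint of \<open>j\<close> times the identity matrix. The map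
  \<open>v \<mapsto> Jmat n (cnj v)\<close> is the quaternionic structure on the complex space of
  dimension \<open>n + n\<close>.\<close>

definition Jmat :: "nat \<Rightarrow> complex mat" where
  "Jmat n = four_block_mat (0\<^sub>m n n) (1\<^sub>m n) (- 1\<^sub>m n) (0\<^sub>m n n)"

lemma Jmat_carrier [simp]: "Jmat n \<in> carrier_mat (n + n) (n + n)"
  by (simp add: Jmat_def)

lemma Jmat_cnj [simp]: "map_mat cnj (Jmat n) = Jmat n"
  by (auto simp: Jmat_def intro!: eq_matI)

lemma Jmat_sq: "Jmat n * Jmat n = - 1\<^sub>m (n + n)"
  unfolding Jmat_def
  by (subst mult_four_block_mat[of _ n n _ n _ n _ _ n _ n]) (auto intro!: eq_matI)

lemma Jmat_inverse: "- Jmat n * Jmat n = 1\<^sub>m (n + n)" "Jmat n * - Jmat n = 1\<^sub>m (n + n)"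
  using carrier_matD[OF Jmat_carrier[of n]] by (simp_all add: Jmat_sq)

text \<open>Multiplying by \<open>Jmat n\<close> merely permutes blocks up to sign, so comparing
  blocks shows that the relation describes exactly the shape of a matrix
  \<open>cadj\<close>.\<close>

lemma Jmat_cnj_eq_iff:
  assumes "A \<in> carrier_mat n n" "B \<in> carrier_mat n n" "C \<in> carrier_mat n n" "D \<in> carrier_mat n n"
  shows "Jmat n * map_mat cnj (four_block_mat A B C D) = four_block_mat A B C D * Jmat n \<longleftrightarrow>
    C = - map_mat cnj B \<and> D = map_mat cnj A"
proof -
  have 1: "Jmat n * map_mat cnj (four_block_mat A B C D) =
    four_block_mat (map_mat cnj C) (map_mat cnj D) (- map_mat cnj A) (- map_mat cnj B)"
    unfolding Jmat_def map_four_block_mat[OF assms]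
    using assms by (subst mult_four_block_mat[of _ n n _ n _ n _ _ n _ n]) auto
  have 2: "four_block_mat A B C D * Jmat n = four_block_mat (- B) A (- D) C"
    unfolding Jmat_def
    using assms by (subst mult_four_block_mat[of _ n n _ n _ n _ _ n _ n]) auto
  show ?thesis
  proof
    assume L: "Jmat n * map_mat cnj (four_block_mat A B C D) = four_block_mat A B C D * Jmat n"
    \<comment> \<open>The two upper blocks suffice; the column offset \<open>n\<close> selects the
      upper right one.\<close>
    have entries: "cnj (C $$ (i, j)) = - B $$ (i, j) \<and> cnj (D $$ (i, j)) = A $$ (i, j)"
      if "i < n" "j < n" for i j
      using arg_cong[OF L[unfolded 1 2], of "\<lambda>M. M $$ (i, j)"]
        arg_cong[OF L[unfolded 1 2], of "\<lambda>M. M $$ (i, j + n)"] that assms by simp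
    have "C $$ (i, j) = - cnj (B $$ (i, j)) \<and> D $$ (i, j) = cnj (A $$ (i, j))"
      if "i < n" "j < n" for i j
      using entries[OF that] by (metis complex_cnj_cnj complex_cnj_minus)
    then show "C = - map_mat cnj B \<and> D = map_mat cnj A"
      using assms by (auto intro!: eq_matI)
  next
    assume "C = - map_mat cnj B \<and> D = map_mat cnj A"
    moreover have "map_mat cnj (- map_mat cnj B) = - B" "map_mat cnj (map_mat cnj A) = A"
      by (auto intro!: eq_matI)
    ultimately show "Jmat n * map_mat cnj (four_block_mat A B C D) = four_block_mat A B C D * Jmat n"
      unfolding 1 2 by simp
  qed
qed

lemma Jmat_cadj:
  assumes "A \<in> carrier_mat n n"
  shows "Jmat n * map_mat cnj (cadj A) = cadj A * Jmat n"
  unfolding cadj_def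
  using assms by (subst Jmat_cnj_eq_iff) (auto intro!: eq_matI)

text \<open>The relation makes the lower blocks of \<open>X\<close> conjugates of the upper blocks
  \<open>B\<close> and \<open>C\<close> up to sign, so \<open>X\<close> comes from the quaternion
  matrix \<open>B + C j\<close>.\<close>

lemma in_range_cadj:
  assumes X: "X \<in> carrier_mat (n + n) (n + n)"
    and JX: "Jmat n * map_mat cnj X = X * Jmat n"
  obtains A where "A \<in> carrier_mat n n" "X = cadj A"
proof -
  obtain B C D E where "split_block X n n = (B, C, D, E)"
    by (metis prod_cases4)
  note sp = split_block[OF this, of n n] 
  have dims: "dim_row X = n + n" "dim_col X = n + n"
    using X by auto
  note c = sp(1-4)[OF dims] and X_eq = sp(5)[OF dims]
  have DE: "D = - map_mat cnj C" "E = map_mat cnj B"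
    using JX unfolding X_eq Jmat_cnj_eq_iff[OF c] by auto
  define A where "A = mat n n (\<lambda>ij. Quat (Re (B $$ ij)) (Im (B $$ ij)) (Re (C $$ ij)) (Im (C $$ ij)))"
  have "map_mat qfst A = B" "map_mat qsnd A = C"
    using c by (auto simp: A_def qfst_def qsnd_def intro!: eq_matI)
  then have "X = cadj A"
    unfolding X_eq DE cadj_def using c by (auto intro!: cong_four_block_mat eq_matI)
  then show thesis
    using that[of A] by (simp add: A_def)
qed

section \<open>Similarity of quaternion matrices and of their adjoints\<close>

lemma similar_mat_cadj:
  assumes "similar_mat A B"
  shows "similar_mat (cadj A) (cadj B)"
proof -
  obtain n P Q where *: "{A, B, P, Q} \<subseteq> carrier_mat n n" "P * Q = 1\<^sub>m n" "Q * P = 1\<^sub>m n"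
    "A = P * B * Q"
    using similar_matD[OF assms] by blast
  then have c: "A \<in> carrier_mat n n" "B \<in> carrier_mat n n" "P \<in> carrier_mat n n" "Q \<in> carrier_mat n n"
    by auto
  show ?thesis
  proof (rule similar_matI[of _ _ "cadj P" "cadj Q" "n + n"])
    show "cadj P * cadj Q = 1\<^sub>m (n + n)" "cadj Q * cadj P = 1\<^sub>m (n + n)"
      using c *(2,3) by (simp_all add: cadj_one flip: cadj_mult)
    have "cadj (P * B * Q) = cadj P * cadj B * cadj Q"
      using c by (simp add: cadj_mult[of _ n] assoc_mult_mat[of _ "n + n" "n + n" _ "n + n" _ "n + n"])
    then show "cadj A = cadj P * cadj B * cadj Q"
      using *(4) by simp
  qed (use c in auto)
qed

lemma cadj_quat_of_complex:
  assumes "M \<in> carrier_mat n n"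
  shows "cadj (map_mat quat_of_complex M) = four_block_mat M (0\<^sub>m n n) (0\<^sub>m n n) (map_mat cnj M)"
  unfolding cadj_def using assms by (auto intro!: cong_four_block_mat eq_matI)

text \<open>The adjoint of a complex matrix is the direct sum of the matrix and its conjugate, so
  every block is accompanied by its conjugate block.\<close>

lemma cadj_jordan_matrix:
  "cadj (map_mat quat_of_complex (jordan_matrix bs)) = jordan_matrix (bs @ cnj_blocks bs)"
  unfolding jordan_matrix_append cadj_quat_of_complex[OF jordan_matrix_carrier] jordan_matrix_cnj
  by (simp add: comp_def)

lemma cnj_cnj_mat [simp]: "map_mat cnj (map_mat cnj A) = A"
  by (auto intro!: eq_matI)

text \<open>If \<open>P\<close> intertwines \<open>cadj A\<close> and \<open>cadj B\<close>, then so does its conjugate \<open>P' = J\<^sup>-\<^sup>1 (cnj P) J\<close>. The matrix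
  \<open>Q t = (1 + t \<i>) P + (1 - t \<i>) P'\<close> is of the form \<open>cadj S\<close> for every real \<open>t\<close>, and invertible for all but
  finitely many \<open>t\<close> because its determinant is a polynomial in \<open>t\<close> with value \<open>det (2 P)\<close> at \<open>t = -\<i>\<close>.\<close>

lemma similar_mat_of_cadj:
  assumes A: "A \<in> carrier_mat n n" and B: "B \<in> carrier_mat n n"
    and sim: "similar_mat (cadj A) (cadj B)"
  shows "similar_mat A B"
proof -
  define m where "m = n + n"
  define X Y J N where "X = cadj A" "Y = cadj B" "J = Jmat n" "N = - Jmat n"
  obtain P P2 where "similar_mat_wit X Y P P2"
    using sim by (auto simp: similar_mat_def X_Y_J_N_def)
  note wit = similar_mat_witD2[OF _ this, of m m]
  have X: "X \<in> carrier_mat m m" and J: "J \<in> carrier_mat m m" and N: "N \<in> carrier_mat m m"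
    using A by (auto simp: m_def X_Y_J_N_def)
  have Y: "Y \<in> carrier_mat m m" and P: "P \<in> carrier_mat m m" and P2: "P2 \<in> carrier_mat m m"
    and PP2: "P * P2 = 1\<^sub>m m" "P2 * P = 1\<^sub>m m" and X_eq: "X = P * Y * P2"
    using wit[OF X] by auto
  note assoc = assoc_mult_mat[of _ m m _ m _ m]
  have cnj_mult: "map_mat cnj (M * M') = map_mat cnj M * map_mat cnj M'"
    if "M \<in> carrier_mat m m" "M' \<in> carrier_mat m m" for M M'
    using cnj_hom.mat_hom_mult[OF that] .
  have JJ: "J * J = - 1\<^sub>m m" and NJ: "N * J = 1\<^sub>m m" "J * N = 1\<^sub>m m"
    and cJ: "map_mat cnj J = J" "map_mat cnj N = N"
  proof -
    show JJ: "J * J = - 1\<^sub>m m"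
      by (simp add: X_Y_J_N_def m_def Jmat_sq)
    show cJ: "map_mat cnj J = J"
      by (simp add: X_Y_J_N_def)
    have N_eq: "N = - J"
      by (simp add: X_Y_J_N_def)
    show "N * J = 1\<^sub>m m" "J * N = 1\<^sub>m m"
      using J by (simp_all add: N_eq JJ)
    have "map_mat cnj (- J) = - map_mat cnj J"
      by (auto intro!: eq_matI)
    then show "map_mat cnj N = N"
      by (simp add: N_eq cJ)
  qed
  have JX: "J * map_mat cnj X = X * J" and JY: "J * map_mat cnj Y = Y * J"
    using Jmat_cadj[OF A] Jmat_cadj[OF B] by (simp_all add: X_Y_J_N_def)
  have XP: "X * P = P * Y"
    using X_eq P Y P2 by (simp add: assoc PP2)
  define P' where "P' = N * map_mat cnj P * J"
  have P': "P' \<in> carrier_mat m m"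
    using P N J by (simp add: P'_def)
  have cP: "map_mat cnj P \<in> carrier_mat m m" "map_mat cnj X \<in> carrier_mat m m"
    "map_mat cnj Y \<in> carrier_mat m m" "map_mat cnj P' \<in> carrier_mat m m"
    using P X Y P' by auto
  have XN: "X * N = N * map_mat cnj X"
  proof -
    have "N * (J * map_mat cnj X) * N = N * (X * J) * N"
      by (simp add: JX)
    then have "(N * J) * (map_mat cnj X * N) = N * X * (J * N)"
      using N J X cP by (simp add: assoc)
    then have "map_mat cnj X * N = N * X"
      using N X cP by (simp add: NJ)
    \<comment> \<open>Since \<open>N\<close> is real, conjugation moves the bar from the left side
      to the right.\<close>
    then have "map_mat cnj (map_mat cnj X * N) = map_mat cnj (N * X)"
      by simp
    then show ?thesis
      using N X cP by (simp add: cnj_mult cJ)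
  qed
  have YJ: "map_mat cnj Y * J = J * Y"
  proof -
    have "map_mat cnj (J * map_mat cnj Y) = map_mat cnj (Y * J)"
      by (simp add: JY)
    then show ?thesis
      using J Y cP by (simp add: cnj_mult cJ)
  qed
  have XP': "X * P' = P' * Y"
  proof -
    have "X * P' = (X * N) * map_mat cnj P * J"
      using X N J cP by (simp add: P'_def assoc)
    also have "\<dots> = N * (map_mat cnj X * map_mat cnj P) * J"
      using N J cP by (simp add: XN assoc)
    also have "map_mat cnj X * map_mat cnj P = map_mat cnj P * map_mat cnj Y"
      using X Y P by (simp add: XP flip: cnj_mult)
    also have "N * (map_mat cnj P * map_mat cnj Y) * J = N * map_mat cnj P * (map_mat cnj Y * J)"
      using N J cP by (simp add: assoc)
    also have "\<dots> = P' * Y"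
      using N J cP Y by (simp add: YJ P'_def assoc)
    finally show ?thesis .
  qed
  \<comment> \<open>This and \<open>JP'\<close> say that conjugation twisted by \<open>J\<close>
    interchanges \<open>P\<close> and \<open>P'\<close>.\<close>
  have JP: "J * map_mat cnj P = P' * J"
  proof -
    have "P' * J = N * map_mat cnj P * (J * J)"
      using N J cP by (simp add: P'_def assoc)
    also have "\<dots> = - (N * map_mat cnj P)"
      using N cP by (simp add: JJ)
    also have "\<dots> = - N * map_mat cnj P"
      using N cP by simp
    also have "- N = J"
      by (simp add: X_Y_J_N_def)
    finally show ?thesis by simp
  qed
  have JP': "J * map_mat cnj P' = P * J"
  proof -
    have "map_mat cnj P' = N * P * J"
      using N J P cP by (simp add: P'_def cnj_mult cJ)
    then have "J * map_mat cnj P' = (J * N) * P * J"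
      using N J P by (simp add: assoc)
    then show ?thesis
      using P by (simp add: NJ)
  qed
  \<comment> \<open>This form is a linear pencil in \<open>t\<close>, as the finiteness of the zeros
    of the determinant requires; \<open>Q_eq\<close> gives the form with conjugate coefficients for
    real \<open>t\<close>.\<close>
  define Q where "Q t = (P + P') + t \<cdot>\<^sub>m (\<i> \<cdot>\<^sub>m (P - P'))" for t :: complex
  have Q_eq: "Q t = (1 + t * \<i>) \<cdot>\<^sub>m P + (1 - t * \<i>) \<cdot>\<^sub>m P'" for t
    using P P' by (auto intro!: eq_matI simp: Q_def algebra_simps)
  have "Q (- \<i>) = 2 \<cdot>\<^sub>m P"
    using P P' by (auto intro!: eq_matI simp: Q_eq)
  moreover have "det P \<noteq> 0"
    using det_mult[OF P P2] by (auto simp: PP2)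
  ultimately have "det (Q (- \<i>)) \<noteq> 0"
    using P by simp
  then have "finite {t. det (Q t) = 0}"
    unfolding Q_def using P P' by (intro finite_zeros_det_pencil[of _ m]) auto
  moreover have "infinite (range complex_of_real)"
    by (simp add: finite_image_iff inj_on_def infinite_UNIV_char_0)
  ultimately obtain t :: real where t: "det (Q (of_real t)) \<noteq> 0"
    by (metis (mono_tags, lifting) finite_subset image_subset_iff mem_Collect_eq)
  define S where "S = Q (of_real t)"
  have S: "S \<in> carrier_mat m m"
    using P P' by (simp add: S_def Q_eq)
  obtain R where R: "R \<in> carrier_mat m m" and RS: "R * S = 1\<^sub>m m" "S * R = 1\<^sub>m m"
    using det_non_zero_imp_unit[OF S t[folded S_def], of "()"]
    by (auto simp: Units_def ring_mat_def)
  have JS: "J * map_mat cnj S = S * J"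
  proof -
    \<comment> \<open>For real \<open>t\<close> the coefficients of \<open>P\<close> and
      \<open>P'\<close> are conjugate, so exchanging both the coefficients and the matrices leaves
      \<open>S\<close> unchanged.\<close>
    let ?c = "1 + of_real t * \<i>"
    have "map_mat cnj S = cnj ?c \<cdot>\<^sub>m map_mat cnj P + ?c \<cdot>\<^sub>m map_mat cnj P'"
      using P P' by (auto intro!: eq_matI simp: S_def Q_eq)
    then have "J * map_mat cnj S = cnj ?c \<cdot>\<^sub>m (P' * J) + ?c \<cdot>\<^sub>m (P * J)"
      using J cP by (simp add: mult_add_distrib_mat[of _ m m _ m] mult_smult_distrib[of _ m m _ m] JP JP')
    also have "\<dots> = (?c \<cdot>\<^sub>m P + cnj ?c \<cdot>\<^sub>m P') * J"
      using J P P' by (simp add: add_mult_distrib_mat[of _ m m _ _ m] mult_smult_assoc_mat[of _ m m _ m]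
          comm_add_mat[of _ m m])
    also have "?c \<cdot>\<^sub>m P + cnj ?c \<cdot>\<^sub>m P' = S"
      by (simp add: S_def Q_eq)
    finally show ?thesis .
  qed
  have XS: "X * S = S * Y"
    using X Y P P' by (simp add: S_def Q_eq XP XP' mult_add_distrib_mat[of _ m m _ m] mult_smult_distrib[of _ m m _ m]
        add_mult_distrib_mat[of _ m m _ _ m] mult_smult_assoc_mat[of _ m m _ m])
  have cSR: "map_mat cnj S \<in> carrier_mat m m" "map_mat cnj R \<in> carrier_mat m m"
    using S R by auto
  \<comment> \<open>The inverse inherits the relation, so it also comes from a quaternion
    matrix.\<close>
  have JR: "J * map_mat cnj R = R * J"
  proof -
    have "J * map_mat cnj R = (R * S) * J * map_mat cnj R"
      using J by (simp add: RS)
    also have "\<dots> = R * (S * J) * map_mat cnj R"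
      using J S R cSR by (simp add: assoc)
    also have "\<dots> = R * J * (map_mat cnj S * map_mat cnj R)"
      using J S R cSR by (simp add: assoc flip: JS)
    also have "map_mat cnj S * map_mat cnj R = 1\<^sub>m m"
      using S R by (simp add: RS cnj_hom.mat_hom_one flip: cnj_mult)
    finally show ?thesis
      using R J by simp
  qed
  obtain S' where S': "S' \<in> carrier_mat n n" "S = cadj S'"
    using in_range_cadj[of S n] S JS by (auto simp: m_def X_Y_J_N_def)
  obtain R' where R': "R' \<in> carrier_mat n n" "R = cadj R'"
    using in_range_cadj[of R n] R JR by (auto simp: m_def X_Y_J_N_def)
  show ?thesis
  proof (rule similar_matI)
    show "{A, B, S', R'} \<subseteq> carrier_mat n n"
      using A B S' R' by auto
    show "S' * R' = 1\<^sub>m n" "R' * S' = 1\<^sub>m n"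
      using S' R' RS by (auto intro!: cadj_inj[of _ n] simp: cadj_mult[of _ n] cadj_one m_def)
    have "cadj (S' * B * R') = cadj (S' * B) * cadj R'"
      using S' R' B by (intro cadj_mult[of _ n]) auto
    also have "\<dots> = S * Y * R"
      using cadj_mult[OF S'(1) B] by (simp only: S'(2) R'(2) X_Y_J_N_def)
    also have "\<dots> = X * (S * R)"
      using X S R by (simp add: assoc flip: XS)
    also have "\<dots> = cadj A"
      using X by (simp add: RS) (simp add: X_Y_J_N_def)
    finally show "A = S' * B * R'"
      using A B S' R' by (intro cadj_inj[of _ n]) auto
  qed
qed

text \<open>For real \<open>r\<close> the matrix \<open>cadj A - r\<close> still satisfies the
  relation with \<open>Jmat n\<close>, because \<open>r\<close> equals its conjugate. The relation
  passes to powers, whose kernels therefore have even dimension.\<close>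

lemma even_dim_gen_eigenspace_cadj:
  assumes A: "A \<in> carrier_mat n n" and r: "r \<in> \<real>"
  shows "even (dim_gen_eigenspace (cadj A) r k)"
proof -
  define m where "m = n + n"
  define X J where "X = cadj A" "J = Jmat n"
  define Y where "Y = char_matrix X r"
  have X: "X \<in> carrier_mat m m" and J: "J \<in> carrier_mat m m"
    using A by (auto simp: m_def X_J_def)
  then have Y: "Y \<in> carrier_mat m m" and cY: "map_mat cnj Y \<in> carrier_mat m m"
    and cX: "map_mat cnj X \<in> carrier_mat m m"
    by (auto simp: Y_def)
  have "map_mat cnj Y = map_mat cnj X + (- r) \<cdot>\<^sub>m 1\<^sub>m m"
    using X r by (auto intro!: eq_matI simp: Y_def char_matrix_def Reals_cnj_iff)
  then have "J * map_mat cnj Y = J * map_mat cnj X + (- r) \<cdot>\<^sub>m J"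
    using J cX by (simp add: mult_add_distrib_mat[of _ m m _ m] mult_smult_distrib[of _ m m _ m])
  also have "\<dots> = X * J + (- r) \<cdot>\<^sub>m J"
    using Jmat_cadj[OF A] by (simp add: X_J_def)
  also have "\<dots> = Y * J"
    using J X by (simp add: Y_def char_matrix_def add_mult_distrib_mat[of _ m m _ _ m] mult_smult_assoc_mat[of _ m m _ m])
  finally have JY: "J * map_mat cnj Y = Y * J" .
  have "J * map_mat cnj Y ^\<^sub>m k = Y ^\<^sub>m k * J"
  proof (induction k)
    case 0
    then show ?case
      using J Y by simp
  next
    case (Suc k)
    have p: "map_mat cnj Y ^\<^sub>m k \<in> carrier_mat m m" "Y ^\<^sub>m k \<in> carrier_mat m m"
      using Y cY by auto
    have "J * map_mat cnj Y ^\<^sub>m Suc k = (J * map_mat cnj Y ^\<^sub>m k) * map_mat cnj Y"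
      using J p cY by (simp add: assoc_mult_mat[of _ m m _ m _ m])
    also have "\<dots> = Y ^\<^sub>m k * (J * map_mat cnj Y)"
      using J p cY by (simp add: Suc.IH assoc_mult_mat[of _ m m _ m _ m])
    also have "\<dots> = Y ^\<^sub>m Suc k * J"
      using J p Y by (simp add: JY assoc_mult_mat[of _ m m _ m _ m])
    finally show ?case .
  qed
  then have "J * map_mat cnj (Y ^\<^sub>m k) = Y ^\<^sub>m k * J"
    by (simp add: cnj_hom.mat_hom_pow[OF Y])
  moreover have "J * map_mat cnj J = - 1\<^sub>m m"
    by (simp add: X_J_def m_def Jmat_sq)
  moreover have "Y ^\<^sub>m k \<in> carrier_mat m m"
    using Y by auto
  ultimately have "even (kernel_dim (Y ^\<^sub>m k))"
    using J by (intro even_kernel_dim[of _ m J])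
  then show ?thesis
    by (simp add: dim_gen_eigenspace_def Y_def X_J_def)
qed

section \<open>The Jordan form of a quaternion matrix\<close>

lemma similar_mat_dim:
  assumes "similar_mat A B" "A \<in> carrier_mat n n"
  shows "B \<in> carrier_mat n n"
  using assms similar_mat_witD2(5) unfolding similar_mat_def by blast

lemma quat_jordan_form_exists:
  assumes A: "A \<in> carrier_mat n n"
  obtains bs where "\<forall>(k, z) \<in> set bs. k \<ge> 1 \<and> Im z \<ge> 0"
    and "similar_mat A (map_mat quat_of_complex (jordan_matrix bs))"
proof -
  define X where "X = cadj A"
  have X: "X \<in> carrier_mat (n + n) (n + n)"
    using A by (simp add: X_def)
  obtain cs where cs: "jordan_nf X cs"
    using jordan_nf_complex_exists[OF X] .
  have pos: "0 \<notin> fst ` set cs" and sim: "similar_mat X (jordan_matrix cs)"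
    using cs by (auto simp: jordan_nf_def)
  \<comment> \<open>The relation with \<open>Jmat n\<close> conjugates \<open>X\<close> into its
    complex conjugate; uniqueness of the Jordan form then makes the multiset of blocks invariant
    under conjugation.\<close>
  have "similar_mat (map_mat cnj X) X"
  proof (rule similar_matI)
    let ?J = "Jmat n" and ?N = "- Jmat n"
    have J: "?J \<in> carrier_mat (n + n) (n + n)" and N: "?N \<in> carrier_mat (n + n) (n + n)"
      by simp_all
    show "{map_mat cnj X, X, ?N, ?J} \<subseteq> carrier_mat (n + n) (n + n)"
      using X J N by auto
    show NJ: "?N * ?J = 1\<^sub>m (n + n)" and "?J * ?N = 1\<^sub>m (n + n)"
      by (rule Jmat_inverse)+
    have "?N * X * ?J = ?N * (X * ?J)"
      by (rule assoc_mult_mat[OF N X J])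
    also have "X * ?J = ?J * map_mat cnj X"
      using Jmat_cadj[OF A] by (simp only: X_def)
    also have "?N * (?J * map_mat cnj X) = ?N * ?J * map_mat cnj X"
      using X by (intro assoc_mult_mat[OF N J, symmetric]) auto
    also have "\<dots> = map_mat cnj X"
      unfolding NJ using X by simp
    finally show "map_mat cnj X = ?N * X * ?J"
      by (rule sym)
  qed
  then have "similar_mat X (map_mat cnj X)"
    by (rule similar_mat_sym)
  also have "similar_mat (map_mat cnj X) (jordan_matrix (cnj_blocks cs))"
    using similar_mat_map[OF cnj_hom.semiring_hom_axioms sim] by (simp add: jordan_matrix_cnj)
  finally (similar_mat_trans) have "jordan_nf X (cnj_blocks cs)"
    using pos by (simp add: jordan_nf_def image_image)
  then have cnj: "mset (cnj_blocks cs) = mset cs"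
    using jordan_nf_mset_unique[OF _ cs] by blast
  have sym: "count (mset cs) (k, cnj z) = count (mset cs) (k, z)" for k z
  proof -
    have "inj (map_prod id cnj :: nat \<times> complex \<Rightarrow> _)"
      by (auto simp: inj_def)
    from count_image_mset_inj[OF this, of "mset cs" "(k, z)"] show ?thesis
      using cnj by simp
  qed
  have even: "even (count (mset cs) (k, z))" if "z \<in> \<real>" for k z
  proof (cases "k = 0")
    case True
    then have "(k, z) \<notin> set cs"
      using pos by force
    then have "count (mset cs) (k, z) = 0"
      by (metis count_eq_zero_iff set_mset_mset)
    then show ?thesis
      by (simp only: even_zero)
  next
    case False
    have "count (mset cs) (k, z) = compute_nr_of_jordan_blocks X z k"
      using compute_nr_of_jordan_blocks[OF cs False, of z]
      by (simp add: count_mset count_list_eq_length_filter)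
    \<comment> \<open>The count is twice the dimension of a generalized eigenspace minus the
      dimensions for the two neighbouring exponents, which are even for real
      \<open>z\<close>.\<close>
    also have "even \<dots>"
      unfolding compute_nr_of_jordan_blocks_def X_def
      by (intro dvd_diff_nat even_dim_gen_eigenspace_cadj[OF A that]) simp
    finally show ?thesis .
  qed
  obtain bs where bs: "\<forall>(k, z) \<in> set bs. (k, z) \<in># mset cs \<and> Im z \<ge> 0"
    and cs_eq: "mset cs = mset (bs @ cnj_blocks bs)"
    using cnj_symmetric_mset[OF sym even] by auto
  have simX: "similar_mat X (cadj (map_mat quat_of_complex (jordan_matrix bs)))"
    unfolding cadj_jordan_matrix
    using sim similar_jordan_matrix_mset_eq[OF cs_eq] by (rule similar_mat_trans)
  \<comment> \<open>The size of the block list is recovered by comparing dimensions of the adjoints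
    and halving.\<close>
  have B: "map_mat quat_of_complex (jordan_matrix bs) \<in> carrier_mat n n"
  proof -
    let ?s = "sum_list (map fst bs)"
    have "cadj (map_mat quat_of_complex (jordan_matrix bs)) \<in> carrier_mat (?s + ?s) (?s + ?s)"
      by (intro cadj_carrier map_carrier_mat[THEN iffD2] jordan_matrix_carrier)
    moreover have "cadj (map_mat quat_of_complex (jordan_matrix bs)) \<in> carrier_mat (n + n) (n + n)"
      using similar_mat_dim[OF simX X] .
    ultimately have "?s + ?s = n + n"
      by (metis carrier_matD(1))
    then have "?s = n"
      by simp
    then show ?thesis
      by (metis jordan_matrix_carrier map_carrier_mat)
  qed
  have "similar_mat A (map_mat quat_of_complex (jordan_matrix bs))"
    by (rule similar_mat_of_cadj[OF A B simX[unfolded X_def]])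
  moreover have "k \<ge> 1 \<and> Im z \<ge> 0" if "(k, z) \<in> set bs" for k z
  proof -
    have "(k, z) \<in> set cs" "Im z \<ge> 0"
      using bs that by auto
    moreover from this(1) have "k \<noteq> 0"
      using pos by force
    ultimately show ?thesis
      by simp
  qed
  ultimately show thesis
    using that by blast
qed

text \<open>Each candidate list together with its conjugates is a Jordan form of
  \<open>cadj A\<close>, hence unique; the condition on imaginary parts then separates the list from
  its conjugates.\<close>

lemma quat_jordan_form_unique:
  assumes bs: "\<forall>(k, z) \<in> set bs. k \<ge> 1 \<and> Im z \<ge> 0"
    and bs': "\<forall>(k, z) \<in> set bs'. k \<ge> 1 \<and> Im z \<ge> 0"
    and sim: "similar_mat A (map_mat quat_of_complex (jordan_matrix bs))"
      "similar_mat A (map_mat quat_of_complex (jordan_matrix bs'))"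
  shows "mset bs = mset bs'"
proof -
  have nf: "jordan_nf (cadj A) (cs @ cnj_blocks cs)"
    if "\<forall>(k, z) \<in> set cs. k \<ge> 1 \<and> Im z \<ge> 0"
      "similar_mat A (map_mat quat_of_complex (jordan_matrix cs))" for cs
  proof -
    have "0 \<notin> fst ` set (cs @ cnj_blocks cs)"
      using that(1) by force
    moreover have "similar_mat (cadj A) (jordan_matrix (cs @ cnj_blocks cs))"
      using similar_mat_cadj[OF that(2)] by (simp add: cadj_jordan_matrix)
    ultimately show ?thesis
      by (simp add: jordan_nf_def)
  qed
  show ?thesis
  proof (rule upper_half_blocks_unique)
    show "mset (bs @ cnj_blocks bs) = mset (bs' @ cnj_blocks bs')"
      using nf[OF bs sim(1)] nf[OF bs' sim(2)] by (rule jordan_nf_mset_unique)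
  qed (use bs bs' in auto)
qed

section \<open>Reduction of consimilarity to similarity\<close>

lemma smult_one_mult_mat:
  fixes M :: "'a::ring_1 mat"
  assumes "M \<in> carrier_mat n n"
  shows "c \<cdot>\<^sub>m 1\<^sub>m n * M = c \<cdot>\<^sub>m M"
proof (rule eq_matI)
  fix i j assume "i < dim_row (c \<cdot>\<^sub>m M)" "j < dim_col (c \<cdot>\<^sub>m M)"
  then show "(c \<cdot>\<^sub>m 1\<^sub>m n * M) $$ (i, j) = (c \<cdot>\<^sub>m M) $$ (i, j)"
    using assms by (simp add: scalar_prod_def if_distrib if_distribR sum.delta cong: if_cong)
qed (use assms in auto)

text \<open>A scalar matrix on the right multiplies entries from the right, which over a
  noncommutative ring differs from scalar multiplication of the matrix.\<close>

lemma mult_smult_one_mat: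
  fixes M :: "'a::ring_1 mat"
  assumes "M \<in> carrier_mat n n"
  shows "M * (c \<cdot>\<^sub>m 1\<^sub>m n) = map_mat (\<lambda>x. x * c) M"
proof (rule eq_matI)
  fix i j assume "i < dim_row (map_mat (\<lambda>x. x * c) M)" "j < dim_col (map_mat (\<lambda>x. x * c) M)"
  then show "(M * (c \<cdot>\<^sub>m 1\<^sub>m n)) $$ (i, j) = map_mat (\<lambda>x. x * c) M $$ (i, j)"
    using assms by (simp add: scalar_prod_def if_distrib if_distribR sum.delta cong: if_cong)
qed (use assms in auto)

text \<open>Multiplying \<open>B = \<sigma>\<^sup>-\<^sup>1 T \<sigma> A S\<close> by \<open>\<sigma>\<close> turns \<open>\<sigma>\<close>-consimilarity into ordinary similarity.\<close>

lemma consimilar_mat_iff_similar: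
  assumes "\<sigma> \<noteq> 0"
  shows "consimilar_mat \<sigma> A B \<longleftrightarrow> similar_mat (\<sigma> \<cdot>\<^sub>m B) (\<sigma> \<cdot>\<^sub>m A)"
proof -
  have key: "B = map_mat (\<lambda>x. inverse \<sigma> * x * \<sigma>) T * A * S \<longleftrightarrow> \<sigma> \<cdot>\<^sub>m B = T * (\<sigma> \<cdot>\<^sub>m A) * S"
    if c: "A \<in> carrier_mat n n" "B \<in> carrier_mat n n" "T \<in> carrier_mat n n" "S \<in> carrier_mat n n"
    for n T S
  proof -
    \<comment> \<open>Writing the scalars as matrices turns the entrywise conjugation of
      \<open>T\<close> into \<open>?E * T * ?D\<close>, and associativity lets \<open>?D\<close> be
      absorbed by \<open>A\<close>.\<close>
    let ?D = "\<sigma> \<cdot>\<^sub>m 1\<^sub>m n" and ?E = "inverse \<sigma> \<cdot>\<^sub>m 1\<^sub>m n :: quat mat"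
    note assoc = assoc_mult_mat[of _ n n _ n _ n]
    have D: "?D \<in> carrier_mat n n" and E: "?E \<in> carrier_mat n n"
      by simp_all
    have "map_mat (\<lambda>x. inverse \<sigma> * x * \<sigma>) T = ?E * (T * ?D)"
      using c by (subst mult_smult_one_mat[of _ n], simp, subst smult_one_mult_mat[of _ n])
        (auto intro!: eq_matI simp: mult.assoc)
    then have "map_mat (\<lambda>x. inverse \<sigma> * x * \<sigma>) T * A * S = ?E * (T * ?D) * A * S"
      by (simp only:)
    also have "\<dots> = ?E * (T * (?D * A) * S)"
      using c D E by (simp only: assoc mult_carrier_mat)
    finally have *: "map_mat (\<lambda>x. inverse \<sigma> * x * \<sigma>) T * A * S = ?E * (T * (\<sigma> \<cdot>\<^sub>m A) * S)"
      unfolding smult_one_mult_mat[OF c(1)] .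
    have "inverse \<sigma> \<cdot>\<^sub>m (\<sigma> \<cdot>\<^sub>m M) = M" "\<sigma> \<cdot>\<^sub>m (inverse \<sigma> \<cdot>\<^sub>m M) = M" for M :: "quat mat"
      using assms by (auto intro!: eq_matI simp flip: mult.assoc)
    moreover have "?E * (T * (\<sigma> \<cdot>\<^sub>m A) * S) = inverse \<sigma> \<cdot>\<^sub>m (T * (\<sigma> \<cdot>\<^sub>m A) * S)"
      using c by (intro smult_one_mult_mat mult_carrier_mat[of _ n n] smult_carrier_mat)
    ultimately show ?thesis
      unfolding * by metis
  qed
  show ?thesis
  proof
    assume "consimilar_mat \<sigma> A B"
    then obtain n S T where *: "{A, B, S, T} \<subseteq> carrier_mat n n" "S * T = 1\<^sub>m n" "T * S = 1\<^sub>m n"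
      "B = map_mat (\<lambda>x. inverse \<sigma> * x * \<sigma>) T * A * S"
      unfolding consimilar_mat_def by blast
    then have c: "A \<in> carrier_mat n n" "B \<in> carrier_mat n n" "T \<in> carrier_mat n n" "S \<in> carrier_mat n n"
      by auto
    show "similar_mat (\<sigma> \<cdot>\<^sub>m B) (\<sigma> \<cdot>\<^sub>m A)"
    proof (rule similar_matI[OF _ *(3,2)])
      show "{\<sigma> \<cdot>\<^sub>m B, \<sigma> \<cdot>\<^sub>m A, T, S} \<subseteq> carrier_mat n n"
        using c by simp
      show "\<sigma> \<cdot>\<^sub>m B = T * (\<sigma> \<cdot>\<^sub>m A) * S"
        by (rule key[OF c, THEN iffD1, OF *(4)])
    qed
  next
    assume sim: "similar_mat (\<sigma> \<cdot>\<^sub>m B) (\<sigma> \<cdot>\<^sub>m A)"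
    then obtain n T S where *: "{\<sigma> \<cdot>\<^sub>m B, \<sigma> \<cdot>\<^sub>m A, T, S} \<subseteq> carrier_mat n n"
      "T * S = 1\<^sub>m n" "S * T = 1\<^sub>m n" "\<sigma> \<cdot>\<^sub>m B = T * (\<sigma> \<cdot>\<^sub>m A) * S"
      using similar_matD[OF sim] by blast
    have "\<sigma> \<cdot>\<^sub>m B \<in> carrier_mat n n" "\<sigma> \<cdot>\<^sub>m A \<in> carrier_mat n n" and TS: "T \<in> carrier_mat n n" "S \<in> carrier_mat n n"
      using *(1) by (simp_all only: insert_subset)
    then have AB: "A \<in> carrier_mat n n" "B \<in> carrier_mat n n"
      by (metis carrier_matD carrier_matI index_smult_mat(2,3))+
    note c = AB TS
    have "B = map_mat (\<lambda>x. inverse \<sigma> * x * \<sigma>) T * A * S"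
      by (rule key[OF c, THEN iffD2, OF *(4)])
    moreover have "{A, B, S, T} \<subseteq> carrier_mat n n"
      using c by simp
    ultimately show "consimilar_mat \<sigma> A B"
      unfolding consimilar_mat_def using *(2,3) by (intro exI conjI)
  qed
qed

lemma semiring_hom_quat_of_complex: "semiring_hom quat_of_complex"
  by unfold_locales (simp_all add: quat_of_complex_def quat_eq_iff)

abbreviation scale_blocks :: "complex \<Rightarrow> (nat \<times> complex) list \<Rightarrow> (nat \<times> complex) list" where
  "scale_blocks c \<equiv> map (\<lambda>(k, z). (k, c * z))"

text \<open>Scaling a Jordan matrix by a nonzero complex \<open>c\<close> gives, up to similarity,
  the Jordan matrix with scaled eigenvalues. This complex similarity is carried over to the
  quaternions.\<close>

lemma consimilar_mat_jordan_matrix_iff: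
  assumes "c \<noteq> 0" and "\<sigma> = quat_of_complex c"
  shows "consimilar_mat \<sigma> A (map_mat quat_of_complex (jordan_matrix bs)) \<longleftrightarrow>
    similar_mat (\<sigma> \<cdot>\<^sub>m A) (map_mat quat_of_complex (jordan_matrix (scale_blocks c bs)))"
proof -
  interpret semiring_hom quat_of_complex
    by (rule semiring_hom_quat_of_complex)
  have nz: "\<sigma> \<noteq> 0"
    using assms by (simp add: quat_of_complex_def quat_eq_iff complex_eq_iff)
  let ?B = "map_mat quat_of_complex (c \<cdot>\<^sub>m jordan_matrix bs)"
    and ?C = "map_mat quat_of_complex (jordan_matrix (scale_blocks c bs))"
  have smult: "\<sigma> \<cdot>\<^sub>m map_mat quat_of_complex (jordan_matrix bs) = ?B"
    by (auto intro!: eq_matI simp: assms(2) hom_mult)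
  have sim: "similar_mat ?B ?C"
    by (rule similar_mat_map[OF semiring_hom_quat_of_complex similar_mat_jordan_matrix_smult[OF assms(1)]])
  have "consimilar_mat \<sigma> A (map_mat quat_of_complex (jordan_matrix bs)) \<longleftrightarrow>
    similar_mat ?B (\<sigma> \<cdot>\<^sub>m A)"
    by (simp only: consimilar_mat_iff_similar[OF nz] smult)
  also have "\<dots> \<longleftrightarrow> similar_mat (\<sigma> \<cdot>\<^sub>m A) ?C"
    using similar_mat_trans[OF similar_mat_sym sim] similar_mat_trans[OF sim similar_mat_sym] by iprover
  finally show ?thesis .
qed

theorem theorem3:
  fixes \<sigma> :: quat and A :: "quat mat" and n :: nat
  assumes "\<sigma> \<in> {1, quat_i}"
    and "A \<in> carrier_mat n n"
  shows "\<exists>bs. canonical_blocks \<sigma> bs \<and>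
      consimilar_mat \<sigma> A (map_mat quat_of_complex (jordan_matrix bs)) \<and>
      (\<forall>bs'. canonical_blocks \<sigma> bs' \<and>
        consimilar_mat \<sigma> A (map_mat quat_of_complex (jordan_matrix bs')) \<longrightarrow>
        mset bs' = mset bs)"
proof -
  \<comment> \<open>Viewing \<open>\<sigma>\<close> as a complex number \<open>c\<close> unifies the
    two sign conditions: both say that \<open>c * z\<close> lies in the closed upper half plane,
    since \<open>Im (\<i> * z) = Re z\<close>.\<close>
  obtain c where c: "c \<in> {1, \<i>}" and \<sigma>: "\<sigma> = quat_of_complex c"
    and half: "\<And>z. Im (c * z) = (if \<sigma> = 1 then Im z else Re z)"
  proof (cases "\<sigma> = 1")
    case True
    then show ?thesis
      by (intro that[of 1]) (simp_all add: quat_of_complex_def quat_eq_iff)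
  next
    case False
    then have "\<sigma> = quat_i"
      using assms(1) by simp
    with False show ?thesis
      by (intro that[of \<i>]) (simp_all add: quat_of_complex_def quat_i_def)
  qed
  have c0: "c \<noteq> 0"
    using c by auto
  \<comment> \<open>This keeps the two implications in \<open>canonical_blocks\<close> from applying
    at once.\<close>
  have "quat_i \<noteq> 1"
    by (simp add: quat_eq_iff quat_i_def)
  then have "canonical_blocks \<sigma> bs \<longleftrightarrow> (\<forall>(k, z) \<in> set bs. k \<ge> 1 \<and> Im (c * z) \<ge> 0)" for bs
    using assms(1) unfolding canonical_blocks_def half by auto
  then have canon: "canonical_blocks \<sigma> bs \<longleftrightarrow>
    (\<forall>(k, z) \<in> set (scale_blocks c bs). k \<ge> 1 \<and> Im z \<ge> 0)" for bs
    by (simp add: case_prod_unfold del: times_complex.sel)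
  note consim = consimilar_mat_jordan_matrix_iff[OF c0 \<sigma>]
  have inj: "inj (\<lambda>(k :: nat, z). (k, c * z))"
    using c0 by (auto simp: inj_def)
  obtain cs where cs: "\<forall>(k, z) \<in> set cs. k \<ge> 1 \<and> Im z \<ge> 0"
    "similar_mat (\<sigma> \<cdot>\<^sub>m A) (map_mat quat_of_complex (jordan_matrix cs))"
    using quat_jordan_form_exists[of "\<sigma> \<cdot>\<^sub>m A" n] assms(2) by auto
  \<comment> \<open>The Jordan form found for the scaled matrix has its eigenvalues divided by
    \<open>c\<close>.\<close>
  define bs where "bs = scale_blocks (inverse c) cs"
  have bs: "scale_blocks c bs = cs"
    using c0 by (auto intro!: map_idI simp: bs_def comp_def case_prod_unfold simp flip: mult.assoc)
  show ?thesis
  proof (intro exI[of _ bs] conjI allI impI)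
    show "canonical_blocks \<sigma> bs" "consimilar_mat \<sigma> A (map_mat quat_of_complex (jordan_matrix bs))"
      using cs by (simp_all only: canon consim bs)
    fix bs'
    assume "canonical_blocks \<sigma> bs' \<and> consimilar_mat \<sigma> A (map_mat quat_of_complex (jordan_matrix bs'))"
    \<comment> \<open>Uniqueness holds for the scaled lists, and scaling by \<open>c\<close> is
      injective on blocks.\<close>
    then have "mset (scale_blocks c bs') = mset (scale_blocks c bs)"
      unfolding bs canon consim using cs by (intro quat_jordan_form_unique[of _ _ "\<sigma> \<cdot>\<^sub>m A"]) auto
    then show "mset bs' = mset bs"
      using count_image_mset_inj[OF inj, of "mset bs'"] count_image_mset_inj[OF inj, of "mset bs"]
      by (intro multiset_eqI) (simp only: mset_map)
  qed
qed

end
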